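(* Let $\mathfrak{g}$ be a finite dimensional real Lie algebra and $\langle\,,\,\rangle$ a Euclidean product on $\mathfrak{g}$ (a positive definite symmetric bilinear form) such that the associated Levi-Civita product is quasi-canonical. Then $\langle\,,\,\rangle$ is bi-invariant, and hence the Levi-Civita product coincides with the canonical product $(u,v)\mapsto\frac12[u,v]$.
   Context: The Levi-Civita product associated to $(\mathfrak{g},[\,,\,],\langle\,,\,\rangle)$ is the bilinear product $(u,v)\mapsto u.v$ defined by $2\langle u.v,w\rangle=\langle[u,v],w\rangle+\langle[w,v],u\rangle+\langle[w,u],v\rangle$ for all $u,v,w\in\mathfrak{g}$. The form $\langle\,,\,\rangle$ is bi-invariant if $\langle[u,v],w\rangle+\langle v,[u,w]\rangle=0$ for all $u,v,w$. A bilinear product $\alpha$ on a finite dimensional Lie algebra $\mathfrak{g}$, with $\mathrm{L}_uv=\alpha(u,v)$, is quasi-canonical if it is Lie-admissible ($\alpha(u,v)-\alpha(v,u)=[u,v]$), bi-invariant ($[u,\alpha(v,w)]=\alpha([u,v],w)+\alpha(v,[u,w])$), and $[\mathrm{L}_u,\mathrm{L}_v]-\mathrm{L}_{[u,v]}=-\frac14\mathrm{ad}_{[u,v]}$, for all $u,v,w\in\mathfrak{g}$. *)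

theory Defs
  imports "HOL-Analysis.Analysis"
begin

definition finite_dimensional :: "'g::real_vector itself \<Rightarrow> bool" where
  "finite_dimensional _ \<longleftrightarrow> (\<exists>B :: 'g set. finite B \<and> span B = UNIV)"

definition lie_bracket :: "('g::real_vector \<Rightarrow> 'g \<Rightarrow> 'g) \<Rightarrow> bool" where
  "lie_bracket br \<longleftrightarrow> bilinear br \<and> (\<forall>u. br u u = 0) \<and>
     (\<forall>u v w. br u (br v w) + br v (br w u) + br w (br u v) = 0)"

definition euclidean_product :: "('g::real_vector \<Rightarrow> 'g \<Rightarrow> real) \<Rightarrow> bool" where
  "euclidean_product ip \<longleftrightarrow> bilinear ip \<and> (\<forall>u v. ip u v = ip v u) \<and>
     (\<forall>u. u \<noteq> 0 \<longrightarrow> ip u u > 0)"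

definition bi_invariant_form ::
  "('g::real_vector \<Rightarrow> 'g \<Rightarrow> 'g) \<Rightarrow> ('g \<Rightarrow> 'g \<Rightarrow> real) \<Rightarrow> bool" where
  "bi_invariant_form br ip \<longleftrightarrow> (\<forall>u v w. ip (br u v) w + ip v (br u w) = 0)"

text \<open>The defining identity determines the product only if the form is nondegenerate and the
  space is finite dimensional; see \<open>levi_civita_product\<close> below for well-definedness.\<close>

definition levi_civita ::
  "('g::real_vector \<Rightarrow> 'g \<Rightarrow> 'g) \<Rightarrow> ('g \<Rightarrow> 'g \<Rightarrow> real) \<Rightarrow> 'g \<Rightarrow> 'g \<Rightarrow> 'g" where
  "levi_civita br ip u v =
     (THE x. \<forall>w. 2 * ip x w = ip (br u v) w + ip (br w v) u + ip (br w u) v)"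

definition lie_admissible ::
  "('g::real_vector \<Rightarrow> 'g \<Rightarrow> 'g) \<Rightarrow> ('g \<Rightarrow> 'g \<Rightarrow> 'g) \<Rightarrow> bool" where
  "lie_admissible br \<alpha> \<longleftrightarrow> (\<forall>u v. \<alpha> u v - \<alpha> v u = br u v)"

definition bi_invariant_product ::
  "('g::real_vector \<Rightarrow> 'g \<Rightarrow> 'g) \<Rightarrow> ('g \<Rightarrow> 'g \<Rightarrow> 'g) \<Rightarrow> bool" where
  "bi_invariant_product br \<alpha> \<longleftrightarrow>
     (\<forall>u v w. br u (\<alpha> v w) = \<alpha> (br u v) w + \<alpha> v (br u w))"

text \<open>The last conjunct is the operator identity
  \<open>[L u, L v] - L [u,v] = - (1/4) ad [u,v]\<close>, with \<open>L u = \<alpha> u\<close>, applied to \<open>w\<close>.\<close>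

definition quasi_canonical ::
  "('g::real_vector \<Rightarrow> 'g \<Rightarrow> 'g) \<Rightarrow> ('g \<Rightarrow> 'g \<Rightarrow> 'g) \<Rightarrow> bool" where
  "quasi_canonical br \<alpha> \<longleftrightarrow>
     bilinear \<alpha> \<and> lie_admissible br \<alpha> \<and> bi_invariant_product br \<alpha> \<and>
     (\<forall>u v w. (\<alpha> u (\<alpha> v w) - \<alpha> v (\<alpha> u w)) - \<alpha> (br u v) w = - (1/4) *\<^sub>R br (br u v) w)"

definition canonical_product ::
  "('g::real_vector \<Rightarrow> 'g \<Rightarrow> 'g) \<Rightarrow> 'g \<Rightarrow> 'g \<Rightarrow> 'g" where
  "canonical_product br u v = (1/2) *\<^sub>R br u v"

lemma euclidean_product_represents_on_span:
  fixes ip :: "'g::real_vector \<Rightarrow> 'g \<Rightarrow> real" and \<phi> :: "'g \<Rightarrow> real"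
  assumes ip: "euclidean_product ip" and "finite B" and "linear \<phi>"
  shows "\<exists>x. x \<in> span B \<and> (\<forall>w \<in> span B. ip x w = \<phi> w)"
  using assms(2,3)
proof (induction B arbitrary: \<phi> rule: finite_induct)
  case empty
  have "bilinear ip" using ip by (simp add: euclidean_product_def)
  then show ?case using empty by (auto simp: bilinear_rzero linear_0)
next
  case (insert b B)
  have bil: "bilinear ip" and sym: "\<And>u v. ip u v = ip v u"
    and pos: "\<And>u. u \<noteq> 0 \<Longrightarrow> ip u u > 0"
    using ip by (auto simp: euclidean_product_def)
  obtain x where x: "x \<in> span B" "\<And>w. w \<in> span B \<Longrightarrow> ip x w = \<phi> w"
    using insert.IH[OF insert.prems] by blast
  have "linear (ip b)" using bil unfolding bilinear_def by simp
  then obtain b' where b': "b' \<in> span B" "\<And>w. w \<in> span B \<Longrightarrow> ip b' w = ip b w"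
    using insert.IH by blast
  define c where "c = b - b'"
  have sub: "span B \<subseteq> span (insert b B)" by (rule span_mono) auto
  have cs: "c \<in> span (insert b B)"
    unfolding c_def
  proof (rule span_diff)
    show "b \<in> span (insert b B)" by (rule span_base) simp
    show "b' \<in> span (insert b B)" using sub b'(1) by (rule subsetD)
  qed
  have c0: "ip c w = 0" if "w \<in> span B" for w
    using b'(2)[OF that] by (simp add: c_def bilinear_lsub[OF bil])
  define t where "t = (if c = 0 then 0 else (\<phi> c - ip x c) / ip c c)"
  have tc: "ip x c + t * ip c c = \<phi> c"
    using pos[of c] by (auto simp: t_def bilinear_rzero[OF bil] linear_0[OF insert.prems])
  have "ip (x + t *\<^sub>R c) w = \<phi> w" if w: "w \<in> span (insert b B)" for w
  proof -
    obtain k where k: "w - k *\<^sub>R b \<in> span B" using w by (auto simp: span_insert)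
    define y where "y = w - k *\<^sub>R b + k *\<^sub>R b'"
    have y: "y \<in> span B" unfolding y_def using k b'(1) by (intro span_add span_scale)
    have wy: "w = y + k *\<^sub>R c" by (simp add: y_def c_def algebra_simps)
    have "ip (x + t *\<^sub>R c) w = ip x y + t * ip c y + k * (ip x c + t * ip c c)"
      by (simp add: wy bilinear_ladd[OF bil] bilinear_radd[OF bil]
          bilinear_lmul[OF bil] bilinear_rmul[OF bil] algebra_simps)
    also have "\<dots> = \<phi> y + k * \<phi> c" using x(2)[OF y] c0[OF y] tc by simp
    also have "\<dots> = \<phi> w"
      by (simp add: wy linear_add[OF insert.prems] linear_cmul[OF insert.prems])
    finally show ?thesis .
  qed
  moreover have "x + t *\<^sub>R c \<in> span (insert b B)"
    using x(1) sub cs by (intro span_add span_scale) auto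
  ultimately show ?case by blast
qed

lemma levi_civita_product:
  fixes br :: "'g::real_vector \<Rightarrow> 'g \<Rightarrow> 'g"
  assumes fd: "finite_dimensional TYPE('g)" and br: "lie_bracket br"
    and ip: "euclidean_product ip"
  shows "2 * ip (levi_civita br ip u v) w = ip (br u v) w + ip (br w v) u + ip (br w u) v"
proof -
  let ?\<phi> = "\<lambda>w. (ip (br u v) w + ip (br w v) u + ip (br w u) v) / 2"
  have bil: "bilinear ip" and pos: "\<And>u. u \<noteq> 0 \<Longrightarrow> ip u u > 0"
    using ip by (auto simp: euclidean_product_def)
  have bbr: "bilinear br" using br by (simp add: lie_bracket_def)
  obtain B :: "'g set" where B: "finite B" "span B = UNIV"
    using fd by (auto simp: finite_dimensional_def)
  have "linear ?\<phi>"
    by (rule linearI)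
      (simp_all add: bilinear_ladd[OF bil] bilinear_radd[OF bil] bilinear_lmul[OF bil]
        bilinear_rmul[OF bil] bilinear_ladd[OF bbr] bilinear_lmul[OF bbr] field_simps)
  then obtain x where x: "\<And>w. ip x w = ?\<phi> w"
    using euclidean_product_represents_on_span[OF ip B(1), of ?\<phi>] B(2) by auto
  let ?P = "\<lambda>x. \<forall>w. 2 * ip x w = ip (br u v) w + ip (br w v) u + ip (br w u) v"
  have ex: "?P x" unfolding x by simp
  have "y = x" if y: "?P y" for y
  proof (rule ccontr)
    assume "y \<noteq> x"
    then have "ip (y - x) (y - x) > 0" using pos by simp
    moreover have "ip y (y - x) = ip x (y - x)"
      using y[rule_format, of "y - x"] ex[rule_format, of "y - x"] by linarith
    ultimately show False by (simp add: bilinear_lsub[OF bil])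
  qed
  with ex have "?P (levi_civita br ip u v)"
    unfolding levi_civita_def by (rule theI[of ?P x])
  then show ?thesis by blast
qed

end

theory Submission
  imports Defs
begin

text \<open>Write the Levi-Civita product as \<open>u.v = [u,v]/2 + s u v\<close>. Torsion-freeness makes \<open>s\<close>
  commutative, bi-invariance makes every \<open>ad u\<close> a derivation of \<open>s\<close>, and then the curvature
  condition says exactly that the operators \<open>s u\<close> commute, so \<open>s\<close> is a commutative associative
  product. Moreover the cyclic sum of \<open>\<langle>s u v, w\<rangle>\<close> vanishes. This excludes nonzero idempotents,
  since \<open>\<langle>s e e, e\<rangle> = 0\<close>; it also makes the annihilator of \<open>s\<close> orthogonal to all products and
  forces elements of square zero into the annihilator. In finite dimension a nonzero \<open>s\<close> would
  have an idempotent, found in the smallest nonzero principal ideal; hence \<open>s = 0\<close>.\<close>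

text \<open>The finite spanning set contains a basis, which interprets
  \<open>finite_dimensional_vector_space\<close>; dimension comparison then applies to a type known
  only to be a \<open>real_vector\<close>.\<close>

lemma finite_dimensional_subspace_eq:
  fixes S T :: "'g::real_vector set"
  assumes "finite_dimensional TYPE('g)" and "subspace S" and "subspace T" and "S \<subseteq> T"
    and "dim T \<le> dim S"
  shows "S = T"
proof -
  obtain C :: "'g set" where C: "finite C" "span C = UNIV"
    using assms(1) by (auto simp: finite_dimensional_def)
  obtain B where B: "B \<subseteq> C" "independent B" "C \<subseteq> span B"
    using real_vector.maximal_independent_subset[of C] by blast
  have "span B = UNIV"
    using C(2) B(3) span_mono[OF B(3)] by (auto simp: span_span)
  then interpret fd: finite_dimensional_vector_space "scaleR :: real \<Rightarrow> 'g \<Rightarrow> 'g" B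
    using B(1,2) finite_subset[OF B(1) C(1)]
    by unfold_locales
      (auto simp: dependent_raw_def span_raw_def)
  show ?thesis
    using fd.subspace_dim_equal[of S T] assms
    by (simp add: subspace_raw_def dim_raw_def)
qed

locale cyclic_comm_algebra =
  fixes s :: "'g::real_vector \<Rightarrow> 'g \<Rightarrow> 'g" and ip :: "'g \<Rightarrow> 'g \<Rightarrow> real"
  assumes bil: "bilinear s"
    and comm: "s u v = s v u"
    and left_comm: "s u (s v w) = s v (s u w)"
    and ip: "euclidean_product ip"
    and cyclic: "ip (s u v) w + ip (s v w) u + ip (s w u) v = 0"
begin

lemma assoc: "s (s u v) w = s u (s v w)"
  by (metis comm left_comm)

lemma definite: "ip x x = 0 \<Longrightarrow> x = 0"
  using ip unfolding euclidean_product_def by force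

lemma idempotent_zero:
  assumes "s e e = e"
  shows "e = 0"
  using cyclic[of e e e] assms by (intro definite) simp

text \<open>If \<open>s w w = 0\<close>, cyclicity makes every \<open>s x w\<close> orthogonal to
  \<open>w\<close>. With \<open>p = s u v\<close>, this applies to \<open>v\<close>,
  \<open>p\<close> and \<open>v + p\<close>; comparing the three leaves
  \<open>ip p p = 0\<close>.\<close>

lemma square_zero_annihilates:
  assumes v: "s v v = 0"
  shows "s u v = 0"
proof -
  have bip: "bilinear ip" using ip by (simp add: euclidean_product_def)
  have zero: "s x 0 = 0" "s 0 x = 0" for x
    using bil by (auto simp: bilinear_rzero bilinear_lzero)
  have skew: "ip (s x w) w = 0" if "s w w = 0" for x w
    using cyclic[of x w w] that comm[of w x] by (simp add: bilinear_lzero[OF bip])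
  have vp: "s v (s u v) = 0" by (metis left_comm v zero(1))
  have pp: "s (s u v) (s u v) = 0" by (metis assoc vp zero(1))
  have "s (v + s u v) (v + s u v) = 0"
    using v vp pp comm[of "s u v" v] by (simp add: bilinear_ladd[OF bil] bilinear_radd[OF bil])
  from skew[OF this, of u]
  have "ip (s u v) v + ip (s u v) (s u v) + ip (s u (s u v)) v + ip (s u (s u v)) (s u v) = 0"
    by (simp add: bilinear_radd[OF bil] bilinear_ladd[OF bip] bilinear_radd[OF bip])
  \<comment> \<open>\<open>s u (s u v)\<close> equals \<open>s (s u u) v\<close>, again a multiple
    of \<open>v\<close>.\<close>
  moreover have "ip (s u (s u v)) v = 0"
    using skew[OF v, of "s u u"] by (simp add: assoc)
  ultimately show ?thesis
    using skew[OF v, of u] skew[OF pp, of u] by (intro definite) simp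
qed

text \<open>Cyclicity at \<open>v\<close>, \<open>v\<close>, \<open>s v v\<close> leaves only the
  squared norm of \<open>s v v\<close>.\<close>

lemma square_in_annihilator_zero:
  assumes "\<And>w. s (s v v) w = 0"
  shows "s v v = 0"
proof -
  have bip: "bilinear ip" using ip by (simp add: euclidean_product_def)
  have "ip (s v v) (s v v) = 0"
    using cyclic[of v v "s v v"] assms[of v] comm[of v "s v v"]
    by (simp add: bilinear_lzero[OF bip])
  then show ?thesis by (rule definite)
qed

theorem product_zero:
  assumes fd: "finite_dimensional TYPE('g)"
  shows "s u v = 0"
proof (rule ccontr)
  let ?P = "\<lambda>x. \<exists>w. s x w \<noteq> 0"
  assume "s u v \<noteq> 0"
  then have "?P u" by blast
  then obtain x where x: "?P x" and min: "\<And>y. ?P y \<Longrightarrow> dim (range (s x)) \<le> dim (range (s y))"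
    using ex_has_least_nat[of ?P u "\<lambda>x. dim (range (s x))"] by blast
  have xx: "s x x \<noteq> 0" using x square_zero_annihilates[of x] comm by metis
  then have "?P (s x x)" using square_in_annihilator_zero by blast
  note le = min[OF this]
  have lin: "linear (s y)" for y using bil by (simp add: bilinear_def)
  \<comment> \<open>Multiples of \<open>s x x\<close> are multiples of \<open>x\<close>, and
    minimality forbids a smaller dimension; hence \<open>s x\<close> maps its own range onto
    itself.\<close>
  have "range (s (s x x)) = range (s x)"
    using le by (intro finite_dimensional_subspace_eq[OF fd] linear_subspace_image lin)
      (auto simp: assoc)
  then have W: "\<exists>w. y = s x (s x w)" if "y \<in> range (s x)" for y
    using that by (auto simp: assoc image_iff set_eq_iff)
  obtain h where h: "s x x = s x (s x h)" using W by blast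
  define f where "f = s x h"
  \<comment> \<open>\<open>f\<close> acts on the ideal \<open>range (s x)\<close> as \<open>x\<close> does, but lies in it.\<close>
  have f: "s f (s x w) = s x (s x w)" for w
    by (metis assoc comm f_def h)
  have surj: "\<exists>w. y = s f (s x w)" if "y \<in> range (s x)" for y
    using W[OF that] f by metis
  obtain a where a: "f = s f (s x a)" using surj[of f] f_def by blast
  define e where "e = s x a"
  obtain b where b: "e = s f (s x b)" using surj[of e] e_def by blast
  have fe: "s f e = f" using a e_def by simp
  \<comment> \<open>As \<open>s f e = f\<close>, the right-hand side is \<open>s f (s x b)\<close>,
    which is \<open>e\<close> again.\<close>
  have "s e e = s (s f e) (s x b)" by (metis assoc b comm)
  then have "e = 0" using fe b by (intro idempotent_zero) simp
  then have "f = 0" using fe bilinear_rzero[OF bil, of f] by simp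
  then show False using xx h f_def bilinear_rzero[OF bil, of x] by simp
qed

end

theorem proposition6p1:
  fixes br :: "'g::real_vector \<Rightarrow> 'g \<Rightarrow> 'g"
    and ip :: "'g \<Rightarrow> 'g \<Rightarrow> real"
  assumes "finite_dimensional TYPE('g)"
    and "lie_bracket br"
    and "euclidean_product ip"
    and "quasi_canonical br (levi_civita br ip)"
  shows "bi_invariant_form br ip \<and> levi_civita br ip = canonical_product br"
proof -
  define L where "L = levi_civita br ip"
  have bbr: "bilinear br"
    and jac: "\<And>u v w. br u (br v w) + br v (br w u) + br w (br u v) = 0"
    using assms(2) by (auto simp: lie_bracket_def)
  have bip: "bilinear ip" and sym: "\<And>u v. ip u v = ip v u"
    using assms(3) by (auto simp: euclidean_product_def)
  have bL: "bilinear L" and adm: "\<And>u v. L u v - L v u = br u v"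
    and inv: "\<And>u v w. br u (L v w) = L (br u v) w + L v (br u w)"
    and curv: "\<And>u v w. (L u (L v w) - L v (L u w)) - L (br u v) w = - (1/4) *\<^sub>R br (br u v) w"
    using assms(4) by (auto simp: quasi_canonical_def lie_admissible_def bi_invariant_product_def L_def)
  have LC: "2 * ip (L u v) w = ip (br u v) w + ip (br w v) u + ip (br w u) v" for u v w
    unfolding L_def by (rule levi_civita_product[OF assms(1-3)])
  have skew: "br v u = - br u v" for u v
    by (metis adm minus_diff_eq)
  have jac': "br (br u v) w = br u (br v w) - br v (br u w)" for u v w
    using jac[of u v w] skew[of w "br u v"] skew[of w u]
    by (simp add: bilinear_rneg[OF bbr] algebra_simps)
  note bsimps = bilinear_ladd[OF bbr] bilinear_radd[OF bbr] bilinear_lmul[OF bbr]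
    bilinear_rmul[OF bbr] bilinear_lsub[OF bbr] bilinear_rsub[OF bbr]
  note Lsimps = bilinear_ladd[OF bL] bilinear_radd[OF bL] bilinear_lmul[OF bL]
    bilinear_rmul[OF bL] bilinear_lsub[OF bL] bilinear_rsub[OF bL]
  note isimps = bilinear_lneg[OF bip] bilinear_lmul[OF bip] bilinear_lsub[OF bip]
  define s where "s u v = L u v - (1/2) *\<^sub>R br u v" for u v
  have bs: "bilinear s"
    unfolding bilinear_def s_def by (auto intro!: linearI simp: bsimps Lsimps algebra_simps)
  note ssimps = bilinear_ladd[OF bs] bilinear_radd[OF bs] bilinear_lmul[OF bs]
    bilinear_rmul[OF bs] bilinear_lsub[OF bs] bilinear_rsub[OF bs]
  have Ls: "L u v = (1/2) *\<^sub>R br u v + s u v" for u v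
    by (simp add: s_def)
  have scomm: "s u v = s v u" for u v
  proof -
    have "s u v - s v u = br u v - (1/2) *\<^sub>R br u v - (1/2) *\<^sub>R br u v"
      using adm[of u v] skew[of v u] by (simp add: s_def algebra_simps)
    also have "\<dots> = 0" by (simp add: diff_diff_eq flip: scaleR_left_distrib)
    finally show ?thesis by simp
  qed
  \<comment> \<open>\<open>br u\<close> is a derivation of \<open>L\<close> by bi-invariance and of
    \<open>br\<close> by the Jacobi identity.\<close>
  have der: "br u (s v w) = s (br u v) w + s v (br u w)" for u v w
    by (simp add: s_def bsimps inv jac' algebra_simps)
  have sleft: "s u (s v w) = s v (s u w)" for u v w
  proof -
    \<comment> \<open>By \<open>der\<close> the terms mixing \<open>s\<close> and \<open>br\<close>
      cancel, and the pure bracket terms already give the right-hand side of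
      \<open>curv\<close>.\<close>
    have "(L u (L v w) - L v (L u w)) - L (br u v) w =
      (s u (s v w) - s v (s u w)) + ((1/4) *\<^sub>R br (br u v) w - (1/2) *\<^sub>R br (br u v) w)
      + ((1/2) *\<^sub>R s (br u v) w - (1/2) *\<^sub>R s (br v u) w - s (br u v) w)"
      by (simp add: Ls bsimps ssimps der jac' algebra_simps)
    also have "(1/2) *\<^sub>R s (br u v) w - (1/2) *\<^sub>R s (br v u) w - s (br u v) w = 0"
      by (simp add: skew[of v u] bilinear_lneg[OF bs] flip: scaleR_left_distrib)
    also have "(1/4) *\<^sub>R br (br u v) w - (1/2) *\<^sub>R br (br u v) w = - (1/4) *\<^sub>R br (br u v) w"
      by (simp flip: scaleR_left_diff_distrib)
    finally show ?thesis using curv[of u v w] by simp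
  qed
  have s_ip: "2 * ip (s u v) w = ip (br w v) u + ip (br w u) v" for u v w
    using LC[of u v w] by (simp add: s_def isimps)
  have scyc: "ip (s u v) w + ip (s v w) u + ip (s w u) v = 0" for u v w
    using s_ip[of u v w] s_ip[of v w u] s_ip[of w u v] skew[of u v] skew[of v w] skew[of u w]
    by (simp add: isimps)
  interpret cyclic_comm_algebra s ip
    using bs scomm sleft assms(3) scyc by unfold_locales
  have s0: "s u v = 0" for u v by (rule product_zero[OF assms(1)])
  \<comment> \<open>Once \<open>s\<close> vanishes, \<open>s_ip\<close> is itself the invariance
    identity.\<close>
  have "ip (br u v) w + ip v (br u w) = 0" for u v w
    using s_ip[of w v u] sym[of v "br u w"] by (simp add: s0 bilinear_lzero[OF bip])
  moreover have "levi_civita br ip = canonical_product br"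
    using Ls by (simp add: s0 fun_eq_iff canonical_product_def flip: L_def)
  ultimately show ?thesis by (simp add: bi_invariant_form_def)
qed

end
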